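(* Let $(w_n)=\{w_n(a,b;p,q)\}$ be the Horadam sequence, $w_0=a$, $w_1=b$, $w_n=pw_{n-1}+qw_{n-2}$ for $n\ge 2$, and let $\widehat{\mathbb{O}G_n}=\mathbb{O}G_n+\mathbb{O}G_{n+1}\epsilon$ be the $n$-th dual Horadam octonion. Then for $n\ge 1$, $$\widehat{\mathbb{O}G_{n}}=\frac{A\underline{\alpha}\alpha^n(1+\alpha \epsilon)-B\underline{\beta}\beta^n(1+\beta \epsilon)}{\alpha - \beta},$$ where $\underline{\alpha}=1e_0+\alpha e_1+\alpha^2e_2+\dots+\alpha^7e_7$ and $\underline{\beta}=1e_0+\beta e_1+\beta^2e_2+\dots+\beta^7e_7$.
   Context: Here $\alpha=\frac{p+\sqrt{p^2+4q}}{2}$ and $\beta=\frac{p-\sqrt{p^2+4q}}{2}$ are the roots of the characteristic equation $t^2-pt-q=0$ of the Horadam sequence, and $A=b-a\beta$, $B=b-a\alpha$. Let $\mathbb{O}$ be the octonions with basis $e_0,e_1,\dots,e_7$ and product $\circ$, where $e_0$ is the identity and $e_i\circ e_j=e_k$ with indices $\{i,j,k\}$ chosen from $\{1,2,3\}$, $\{1,4,5\}$, $\{1,7,6\}$, $\{2,4,6\}$, $\{2,5,7\}$, $\{3,4,7\}$, $\{3,6,5\}$. A dual octonion is $\widehat{K}=(k,l)=k+l\epsilon$ with $k,l\in\mathbb{O}$ and $\epsilon^2=0$, $\epsilon\neq 0$; addition is componentwise and the product of $(k,l)$ and $(m,n)$ is $(k\circ m,\,k\circ n+l\circ m)$. The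 $n$-th Horadam octonion is $\mathbb{O}G_n=w_ne_0+w_{n+1}e_1+\dots+w_{n+7}e_7$, and the $n$-th dual Horadam octonion is $\widehat{\mathbb{O}G_n}=(\mathbb{O}G_n,\mathbb{O}G_{n+1})=\mathbb{O}G_n+\mathbb{O}G_{n+1}\epsilon$. *)

theory Defs
  imports "HOL-Analysis.Analysis"
begin

fun horadam :: "'a::comm_ring_1 \<Rightarrow> 'a \<Rightarrow> 'a \<Rightarrow> 'a \<Rightarrow> nat \<Rightarrow> 'a" where
  "horadam a b p q 0 = a"
| "horadam a b p q (Suc 0) = b"
| "horadam a b p q (Suc (Suc n)) = p * horadam a b p q (Suc n) + q * horadam a b p q n"


text \<open>Octonions with coefficients in \<open>'a\<close> are coordinate vectors with respect to the basis
  $e_0, \dots, e_7$; \<open>real octonion\<close> is the usual algebra and \<open>complex octonion\<close> its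
  complexification.  The index type \<open>8\<close> consists of the residues modulo 8. The
  octonion product is \<open>oct_mult\<close>; the library's operation \<open>*\<close> on vectors is not used.\<close>

type_synonym 'a octonion = "'a ^ 8"

definition oct_e :: "nat \<Rightarrow> 'a::zero_neq_one octonion" where
  "oct_e i = axis (of_nat i) 1"

definition oct_triples :: "(nat \<times> nat \<times> nat) set" where
  "oct_triples = {(1,2,3), (1,4,5), (1,7,6), (2,4,6), (2,5,7), (3,4,7), (3,6,5)}"

definition oct_cyc :: "nat \<Rightarrow> nat \<Rightarrow> nat \<Rightarrow> bool" where
  "oct_cyc i j k \<longleftrightarrow>
     (i,j,k) \<in> oct_triples \<or> (j,k,i) \<in> oct_triples \<or> (k,i,j) \<in> oct_triples"

text \<open>The coefficient of $e_k$ in the product of $e_i$ and $e_j$.  The listed triples are oriented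
  and are read up to cyclic permutation; the imaginary units anticommute and square to $-e_0$.\<close>

definition oct_struct :: "nat \<Rightarrow> nat \<Rightarrow> nat \<Rightarrow> 'a::ring_1" where
  "oct_struct i j k =
    (if i = 0 then of_bool (k = j)
     else if j = 0 then of_bool (k = i)
     else if i = j then - of_bool (k = 0)
     else if oct_cyc i j k then 1
     else if oct_cyc j i k then - 1
     else 0)"

definition oct_mult :: "'a::comm_ring_1 octonion \<Rightarrow> 'a octonion \<Rightarrow> 'a octonion"
    (infixl "\<circ>\<^sub>O" 70) where
  "x \<circ>\<^sub>O y = (\<Sum>i<8. \<Sum>j<8. \<Sum>k<8.
      (oct_struct i j k * (x $ of_nat i) * (y $ of_nat j)) *s oct_e k)"


text \<open>The pair \<open>(k, l)\<close> is the dual octonion $k + l\epsilon$; addition and subtraction are the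
  componentwise library operations on pairs.\<close>

type_synonym 'a dual_octonion = "'a octonion \<times> 'a octonion"

definition dual_mult :: "'a::comm_ring_1 dual_octonion \<Rightarrow> 'a dual_octonion \<Rightarrow> 'a dual_octonion"
    (infixl "\<circ>\<^sub>D" 70) where
  "x \<circ>\<^sub>D y = (fst x \<circ>\<^sub>O fst y, fst x \<circ>\<^sub>O snd y + snd x \<circ>\<^sub>O fst y)"

definition dual_scale :: "'a::comm_ring_1 \<Rightarrow> 'a dual_octonion \<Rightarrow> 'a dual_octonion"
    (infixr "*\<^sub>D" 75) where
  "c *\<^sub>D x = (c *s fst x, c *s snd x)"

definition dual_of_oct :: "'a::comm_ring_1 octonion \<Rightarrow> 'a dual_octonion" where
  "dual_of_oct x = (x, 0)"

definition dual_one :: "'a::comm_ring_1 dual_octonion" where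
  "dual_one = (oct_e 0, 0)"

definition dual_eps :: "'a::comm_ring_1 dual_octonion" where
  "dual_eps = (0, oct_e 0)"


definition horadam_oct :: "'a::comm_ring_1 \<Rightarrow> 'a \<Rightarrow> 'a \<Rightarrow> 'a \<Rightarrow> nat \<Rightarrow> 'a octonion" where
  "horadam_oct a b p q n = (\<Sum>i<8. horadam a b p q (n + i) *s oct_e i)"

definition dual_horadam_oct :: "'a::comm_ring_1 \<Rightarrow> 'a \<Rightarrow> 'a \<Rightarrow> 'a \<Rightarrow> nat \<Rightarrow> 'a dual_octonion" where
  "dual_horadam_oct a b p q n = (horadam_oct a b p q n, horadam_oct a b p q (Suc n))"

text \<open>The octonion written $\underline{x}$.\<close>

definition oct_powers :: "'a::comm_ring_1 \<Rightarrow> 'a octonion" where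
  "oct_powers x = (\<Sum>i<8. x ^ i *s oct_e i)"

text \<open>The embedding of the real dual octonions into their complexification, needed when the
  characteristic roots are not real.\<close>

definition complexify :: "real dual_octonion \<Rightarrow> complex dual_octonion" where
  "complexify x = ((\<chi> i. of_real (fst x $ i)), (\<chi> i. of_real (snd x $ i)))"


lemma of_nat_8_eq_iff:
  assumes "i < 8" "j < 8"
  shows "(of_nat i :: 8) = of_nat j \<longleftrightarrow> i = j"
proof -
  have "i \<in> {0,1,2,3,4,5,6,7}" "j \<in> {0,1,2,3,4,5,6,7}" using assms by auto
  then show ?thesis by auto
qed

lemma oct_e_nth:
  "i < 8 \<Longrightarrow> j < 8 \<Longrightarrow> (oct_e i :: 'a::zero_neq_one octonion) $ of_nat j = of_bool (j = i)"
  using of_nat_8_eq_iff[of i j] by (auto simp: oct_e_def axis_def)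

lemma oct_e_mult:
  assumes "i < 8" "j < 8"
  shows "(oct_e i :: 'a::comm_ring_1 octonion) \<circ>\<^sub>O oct_e j = (\<Sum>k<8. oct_struct i j k *s oct_e k)"
proof -
  have "(oct_e i :: 'a octonion) \<circ>\<^sub>O oct_e j =
      (\<Sum>i'<8. \<Sum>j'<8. if i' = i then if j' = j then \<Sum>k<8. oct_struct i j k *s oct_e k else 0 else 0)"
    unfolding oct_mult_def
    by (intro sum.cong refl) (auto simp: oct_e_nth assms)
  also have "\<dots> = (\<Sum>i'<8. if i' = i then \<Sum>k<8. oct_struct i j k *s oct_e k else 0)"
    using assms by (intro sum.cong refl) auto
  also have "\<dots> = (\<Sum>k<8. oct_struct i j k *s oct_e k)"
    using assms by simp
  finally show ?thesis .
qed

lemma oct_e_mult_triple: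
  assumes "(i, j, k) \<in> oct_triples"
  shows "(oct_e i :: 'a::comm_ring_1 octonion) \<circ>\<^sub>O oct_e j = oct_e k"
    and "(oct_e j :: 'a octonion) \<circ>\<^sub>O oct_e k = oct_e i"
    and "(oct_e k :: 'a octonion) \<circ>\<^sub>O oct_e i = oct_e j"
    and "(oct_e j :: 'a octonion) \<circ>\<^sub>O oct_e i = - oct_e k"
  using assms unfolding oct_triples_def
  by (auto simp: oct_e_mult oct_struct_def oct_cyc_def oct_triples_def vector_smult_lneg eval_nat_numeral)

lemma oct_e_square:
  assumes "0 < i" "i < 8"
  shows "(oct_e i :: 'a::comm_ring_1 octonion) \<circ>\<^sub>O oct_e i = - oct_e 0"
  using assms by (simp add: oct_e_mult oct_struct_def if_distrib[of "\<lambda>c. c *s _"] vector_smult_lneg eval_nat_numeral)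

lemma dual_eps_square: "(dual_eps :: 'a::comm_ring_1 dual_octonion) \<circ>\<^sub>D dual_eps = 0"
  by (simp add: dual_eps_def dual_mult_def oct_mult_def zero_prod_def)

end

theory Submission
  imports Defs
begin

text \<open>Right multiplication by \<open>1 + x\<epsilon>\<close> sends an octonion \<open>k\<close> to
  the pair \<open>(k, x k)\<close>, so both dual components reduce to the Binet formula for the
  scalar Horadam sequence, which holds over any field containing two distinct characteristic
  roots.\<close>

lemma horadam_binet:
  fixes \<alpha> \<beta> a b :: "'a::field"
  assumes "\<alpha> \<noteq> \<beta>"
  shows "horadam a b (\<alpha> + \<beta>) (- (\<alpha> * \<beta>)) n =
    ((b - a * \<beta>) * \<alpha> ^ n - (b - a * \<alpha>) * \<beta> ^ n) / (\<alpha> - \<beta>)"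
proof -
  \<comment> \<open>With the denominator cleared, and \<open>p\<close>, \<open>q\<close> expressed
    through the roots, the induction uses only ring identities.\<close>
  have "horadam a b (\<alpha> + \<beta>) (- (\<alpha> * \<beta>)) n * (\<alpha> - \<beta>) =
    (b - a * \<beta>) * \<alpha> ^ n - (b - a * \<alpha>) * \<beta> ^ n"
  proof (induction n rule: induct_nat_012)
    case (ge2 n)
    let ?h = "horadam a b (\<alpha> + \<beta>) (- (\<alpha> * \<beta>))"
    \<comment> \<open>The recurrence is grouped so that the left-hand sides of both induction
      hypotheses occur literally.\<close>
    have "?h (Suc (Suc n)) * (\<alpha> - \<beta>) =
      (\<alpha> + \<beta>) * (?h (Suc n) * (\<alpha> - \<beta>)) - \<alpha> * \<beta> * (?h n * (\<alpha> - \<beta>))"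
      by (simp add: algebra_simps)
    then show ?case
      unfolding ge2.IH by (simp add: algebra_simps)
  qed (simp_all add: algebra_simps)
  then show ?thesis
    using assms by (simp add: eq_divide_eq)
qed

text \<open>Bridges the natural-number indices of the sums and the residues modulo 8 that index
  coordinates: every residue is \<open>of_nat j\<close> for some j < 8.\<close>

lemma octonion_expansion:
  fixes x :: "'a::comm_ring_1 octonion"
  shows "(\<Sum>i<8. x $ of_nat i *s oct_e i) = x"
proof -
  \<comment> \<open>Surjectivity by counting: \<open>of_nat\<close> is injective on eight numbers
    and its target type has eight elements.\<close>
  have "(UNIV :: 8 set) = of_nat ` {..<8}"
  proof (rule card_seteq[symmetric])
    have "inj_on (of_nat :: nat \<Rightarrow> 8) {..<8}"
      by (auto intro!: inj_onI simp: of_nat_8_eq_iff)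
    then show "card (UNIV :: 8 set) \<le> card ((of_nat :: nat \<Rightarrow> 8) ` {..<8})"
      by (simp add: card_image)
  qed auto
  then have "\<exists>j<8. m = of_nat j" for m :: 8
    by blast
  moreover have "(\<Sum>i<8. x $ of_nat i *s oct_e i) $ of_nat j = x $ of_nat j" if "j < 8" for j
  proof -
    have "(\<Sum>i<8. x $ of_nat i *s oct_e i) $ of_nat j
        = (\<Sum>i<8. if i = j then x $ of_nat i else 0)"
      using that by (auto simp: oct_e_nth intro!: sum.cong)
    then show ?thesis
      using that by simp
  qed
  ultimately show ?thesis
    unfolding vec_eq_iff by metis
qed

text \<open>Only j = 0 contributes to the product, and \<open>oct_struct i 0 k\<close> is the
  Kronecker delta, so the triple sum collapses to the basis expansion of c x.\<close>

lemma oct_mult_scaled_one_right: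
  fixes x :: "'a::comm_ring_1 octonion"
  shows "x \<circ>\<^sub>O (c *s oct_e 0) = c *s x"
proof -
  have "x \<circ>\<^sub>O (c *s oct_e 0) =
      (\<Sum>i<8. \<Sum>j<8::nat. if j = 0
        then \<Sum>k<8. if k = i then (c * x $ of_nat i) *s oct_e k else 0 else 0)"
    unfolding oct_mult_def
  proof (intro sum.cong refl)
    fix i j :: nat
    assume "i \<in> {..<8}" "j \<in> {..<8}"
    moreover have "(oct_e 0 :: 'a octonion) $ of_nat j = of_bool (j = 0)"
      using \<open>j \<in> {..<8}\<close> by (intro oct_e_nth) auto
    moreover have "oct_struct i 0 k = (of_bool (k = i) :: 'a)" for k
      by (simp add: oct_struct_def)
    ultimately show "(\<Sum>k<8. (oct_struct i j k * (x $ of_nat i) * ((c *s oct_e 0) $ of_nat j)) *s oct_e k) =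
        (if j = 0 then \<Sum>k<8. if k = i then (c * x $ of_nat i) *s oct_e k else 0 else 0)"
      \<comment> \<open>The delta rules are switched off so that the inner sums keep their shape and
        can be compared term by term.\<close>
      by (auto simp: mult.commute simp del: sum.delta sum.delta' intro!: sum.cong)
  qed
  also have "\<dots> = (\<Sum>i<8. (c *s x) $ of_nat i *s oct_e i)"
    by (intro sum.cong refl) simp
  also have "\<dots> = c *s x"
    by (rule octonion_expansion)
  finally show ?thesis .
qed

lemma dual_of_oct_mult_one_plus_eps:
  fixes k :: "'a::comm_ring_1 octonion"
  shows "dual_of_oct k \<circ>\<^sub>D (dual_one + x *\<^sub>D dual_eps) = (k, x *s k)"
  \<comment> \<open>The factor is the pair of \<open>oct_e 0\<close> and
    \<open>x *s oct_e 0\<close>: the instance 1 gives the first component, the instance x the dual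
    one.\<close>
  using oct_mult_scaled_one_right[of k 1] oct_mult_scaled_one_right[of k x]
  by (simp add: dual_of_oct_def dual_mult_def dual_one_def dual_eps_def dual_scale_def oct_mult_def)

text \<open>Coordinate i carries \<alpha>^(n+i) = \<alpha>^n \<alpha>^i; pulling out \<alpha>^n
  leaves the coordinates of \<open>oct_powers \<alpha>\<close>, and likewise for \<beta>.\<close>

lemma horadam_oct_binet:
  fixes \<alpha> \<beta> a b :: "'a::field"
  assumes "\<alpha> \<noteq> \<beta>"
  shows "horadam_oct a b (\<alpha> + \<beta>) (- (\<alpha> * \<beta>)) n = (1 / (\<alpha> - \<beta>)) *s
    (((b - a * \<beta>) * \<alpha> ^ n) *s oct_powers \<alpha> - ((b - a * \<alpha>) * \<beta> ^ n) *s oct_powers \<beta>)"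
  unfolding horadam_oct_def oct_powers_def horadam_binet[OF assms] vec.scale_sum_right
    sum_subtractf[symmetric]
  by (intro sum.cong refl) (simp add: vec_eq_iff power_add algebra_simps
    add_divide_distrib diff_divide_distrib)

text \<open>The shift to \<open>Suc n\<close> in the dual part supplies one more factor \<alpha> or
  \<beta>, exactly the scalar produced by 1 + \<alpha>\<epsilon> or 1 + \<beta>\<epsilon>. Vieta's
  relations are premises, so real and complex root formulas both fit.\<close>

lemma dual_horadam_oct_binet:
  fixes \<alpha> \<beta> a b :: "'a::field"
  assumes "\<alpha> \<noteq> \<beta>" "p = \<alpha> + \<beta>" "q = - (\<alpha> * \<beta>)"
  shows "dual_horadam_oct a b p q n = (1 / (\<alpha> - \<beta>)) *\<^sub>D
    (dual_of_oct (((b - a * \<beta>) * \<alpha> ^ n) *s oct_powers \<alpha>) \<circ>\<^sub>D (dual_one + \<alpha> *\<^sub>D dual_eps)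
     - dual_of_oct (((b - a * \<alpha>) * \<beta> ^ n) *s oct_powers \<beta>) \<circ>\<^sub>D (dual_one + \<beta> *\<^sub>D dual_eps))"
  unfolding assms(2,3) dual_horadam_oct_def horadam_oct_binet[OF assms(1)]
    dual_of_oct_mult_one_plus_eps
  unfolding dual_scale_def
  by (simp add: vector_smult_assoc mult_ac)

lemma horadam_of_real:
  "horadam (of_real a) (of_real b) (of_real p) (of_real q) n =
    (of_real (horadam a b p q n) :: 'a::{real_algebra_1,comm_ring_1})"
  by (induction n rule: induct_nat_012) simp_all

text \<open>Transfers the claim to the complex field, where the roots exist for either sign of the
  discriminant.\<close>

lemma complexify_dual_horadam_oct:
  "complexify (dual_horadam_oct a b p q n) =
    dual_horadam_oct (complex_of_real a) (complex_of_real b) (complex_of_real p) (complex_of_real q) n"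
  unfolding complexify_def dual_horadam_oct_def horadam_oct_def horadam_of_real
  by (simp add: vec_eq_iff oct_e_def axis_def if_distrib[of complex_of_real] cong: if_cong)

theorem theorem3p1:
  fixes a b p q :: real and n :: nat
  assumes "n \<ge> 1" and "p\<^sup>2 + 4 * q \<noteq> 0"
  shows
    "(p\<^sup>2 + 4 * q > 0 \<longrightarrow>
       (let \<alpha> = (p + sqrt (p\<^sup>2 + 4 * q)) / 2;
            \<beta> = (p - sqrt (p\<^sup>2 + 4 * q)) / 2;
            A = b - a * \<beta>;
            B = b - a * \<alpha>
        in dual_horadam_oct a b p q n =
             (1 / (\<alpha> - \<beta>)) *\<^sub>D
               (dual_of_oct ((A * \<alpha> ^ n) *s oct_powers \<alpha>) \<circ>\<^sub>D (dual_one + \<alpha> *\<^sub>D dual_eps)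
                - dual_of_oct ((B * \<beta> ^ n) *s oct_powers \<beta>) \<circ>\<^sub>D (dual_one + \<beta> *\<^sub>D dual_eps))))
     \<and>
     (let \<alpha> = (complex_of_real p + csqrt (complex_of_real (p\<^sup>2 + 4 * q))) / 2;
          \<beta> = (complex_of_real p - csqrt (complex_of_real (p\<^sup>2 + 4 * q))) / 2;
          A = complex_of_real b - complex_of_real a * \<beta>;
          B = complex_of_real b - complex_of_real a * \<alpha>
      in complexify (dual_horadam_oct a b p q n) =
           (1 / (\<alpha> - \<beta>)) *\<^sub>D
             (dual_of_oct ((A * \<alpha> ^ n) *s oct_powers \<alpha>) \<circ>\<^sub>D (dual_one + \<alpha> *\<^sub>D dual_eps)
              - dual_of_oct ((B * \<beta> ^ n) *s oct_powers \<beta>) \<circ>\<^sub>D (dual_one + \<beta> *\<^sub>D dual_eps)))"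
proof (intro conjI impI)
  assume "p\<^sup>2 + 4 * q > 0"
  then show "let \<alpha> = (p + sqrt (p\<^sup>2 + 4 * q)) / 2;
            \<beta> = (p - sqrt (p\<^sup>2 + 4 * q)) / 2;
            A = b - a * \<beta>;
            B = b - a * \<alpha>
        in dual_horadam_oct a b p q n =
             (1 / (\<alpha> - \<beta>)) *\<^sub>D
               (dual_of_oct ((A * \<alpha> ^ n) *s oct_powers \<alpha>) \<circ>\<^sub>D (dual_one + \<alpha> *\<^sub>D dual_eps)
                - dual_of_oct ((B * \<beta> ^ n) *s oct_powers \<beta>) \<circ>\<^sub>D (dual_one + \<beta> *\<^sub>D dual_eps))"
    unfolding Let_def
    by (intro dual_horadam_oct_binet) (auto simp: field_simps simp flip: power2_eq_square)
next
  \<comment> \<open>The roots differ by d, so a nonzero discriminant makes them distinct.\<close>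
  define d where "d = csqrt (complex_of_real (p\<^sup>2 + 4 * q))"
  have "d \<noteq> 0"
    using assms(2) unfolding d_def csqrt_eq_0 of_real_eq_0_iff .
  have d_square: "d * d = (complex_of_real p)\<^sup>2 + 4 * complex_of_real q"
    unfolding d_def power2_eq_square[symmetric] power2_csqrt by simp
  show "let \<alpha> = (complex_of_real p + csqrt (complex_of_real (p\<^sup>2 + 4 * q))) / 2;
          \<beta> = (complex_of_real p - csqrt (complex_of_real (p\<^sup>2 + 4 * q))) / 2;
          A = complex_of_real b - complex_of_real a * \<beta>;
          B = complex_of_real b - complex_of_real a * \<alpha>
      in complexify (dual_horadam_oct a b p q n) =
           (1 / (\<alpha> - \<beta>)) *\<^sub>D
             (dual_of_oct ((A * \<alpha> ^ n) *s oct_powers \<alpha>) \<circ>\<^sub>D (dual_one + \<alpha> *\<^sub>D dual_eps)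
              - dual_of_oct ((B * \<beta> ^ n) *s oct_powers \<beta>) \<circ>\<^sub>D (dual_one + \<beta> *\<^sub>D dual_eps))"
    unfolding Let_def complexify_dual_horadam_oct d_def[symmetric]
  proof (rule dual_horadam_oct_binet)
    show "(complex_of_real p + d) / 2 \<noteq> (complex_of_real p - d) / 2"
      using \<open>d \<noteq> 0\<close> by (simp add: eq_neg_iff_add_eq_0)
    \<comment> \<open>The product of the roots is (p^2 - d^2)/4, which is -q because d^2 = p^2 +
      4q.\<close>
    show "complex_of_real q = - ((complex_of_real p + d) / 2 * ((complex_of_real p - d) / 2))"
      using d_square by (simp add: power2_eq_square algebra_simps)
  qed (simp add: field_simps)
qed

end
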